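(* Consider the coupled Ginzburg-Landau system, for complex-valued functions $A(t,y)$, $B(t,y)$ of $t\in\mathbb{R}$, $y\in\mathbb{R}$, $$\partial_t A = (i\omega_0 + a_3\tau)A + b_1\mathfrak{R}\,\partial_y A - a_4\mathfrak{R}^2\,\partial_y^2 A + A\,(b|A|^2 + c|B|^2),$$ $$\partial_t B = (i\omega_0 + a_3\tau)B + b_1\mathfrak{R}\,\partial_y B - a_4\mathfrak{R}^2\,\partial_y^2 B + B\,(c|A|^2 + b|B|^2).$$ This system admits solutions of the form $$A(t,y) = r_0\, e^{(i\omega_0 + i a_{3i}\tau + i a_{4i}\beta^2)t + i\beta (y + b_{1r} t) + i\theta_0(t)},$$ $$B(t,y) = r_1\, e^{(i\omega_0 + i a_{3i}\tau + i a_{4i}\beta^2)t + i\beta (y + b_{1r} t) + i\theta_1(t)},$$ where $r_0$ and $r_1$ are real numbers, $\theta_0(t)$ and $\theta_1(t)$ are linear in $t$, and $\tau = T - T_c$. When $r_0\neq 0$ and $r_1=0$, the solutions are helicoidal waves, and when $r_0=r_1\neq 0$, they are ribbon waves.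
   Context: The indices $r$ and $i$ denote the real and imaginary parts of a complex number (so $a_{3i}=\operatorname{Im} a_3$, $a_{4i}=\operatorname{Im} a_4$, $b_{1r}=\operatorname{Re} b_1$). The system is the principal part (higher-order terms dropped) of the amplitude equations for the Couette-Taylor problem (viscous flow between two rotating cylinders) in the small-gap limit, near a non-axisymmetric onset of instability. Here $T$ is the Taylor number, $T_c$ its critical value, $\mathfrak{R}>0$ is a (large) Reynolds-type parameter, and $\beta\in\mathbb{R}$ is a wave number in the azimuthal variable $y$. The coefficients satisfy $\omega_0, b_1\in\mathbb{R}$ and $a_3,a_4,b,c\in\mathbb{C}$, with $\operatorname{Re} a_3>0$ and $\operatorname{Re} a_4<0$. The fluid velocity is, at leading order, $A\zeta_1+B\zeta_2+\overline{A}\,\overline{\zeta_1}+\overline{B}\,\overline{\zeta_2}$, where $\zeta_1,\zeta_2$ are the critical eigenvectors, exchanged by the reflection $z\mapsto -z$ of the axial variable $z$. A helicoidal wave travels in both the azimuthal and the axial directions; a ribbon wave is standing in the axial direction and travels in the azimuthal direction.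
   Formalization: The solutions are shown to be helicoidal or ribbon waves only when the total frequency and the total azimuthal wave number (that of the critical mode plus β) are nonzero; otherwise the flow is steady or independent of y and does not travel azimuthally. *)

theory Defs
  imports "HOL-Analysis.Analysis"
begin

text \<open>Amplitudes are functions of \<open>t\<close> and \<open>y\<close>, in this order.\<close>

type_synonym amplitude = "real \<Rightarrow> real \<Rightarrow> complex"

definition dt :: "amplitude \<Rightarrow> amplitude" where
  "dt A t y = vector_derivative (\<lambda>s. A s y) (at t)"

definition dy :: "amplitude \<Rightarrow> amplitude" where
  "dy A t y = vector_derivative (\<lambda>s. A t s) (at y)"

text \<open>\<^const>\<open>vector_derivative\<close> is total, so the existence of the derivatives that
  occur in the system has to be required separately.\<close>

definition has_partials :: "amplitude \<Rightarrow> bool" where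
  "has_partials A \<longleftrightarrow> (\<forall>t y.
     (\<lambda>s. A s y) differentiable (at t) \<and>
     (\<lambda>s. A t s) differentiable (at y) \<and>
     (\<lambda>s. dy A t s) differentiable (at y))"

definition gl_solution ::
    "real \<Rightarrow> real \<Rightarrow> real \<Rightarrow> complex \<Rightarrow> complex \<Rightarrow> complex \<Rightarrow> complex \<Rightarrow> real
      \<Rightarrow> amplitude \<Rightarrow> amplitude \<Rightarrow> bool" where
  "gl_solution \<omega>0 b1 R a3 a4 b c \<tau> A B \<longleftrightarrow>
     has_partials A \<and> has_partials B \<and>
     (\<forall>t y.
       dt A t y = (\<i> * of_real \<omega>0 + a3 * of_real \<tau>) * A t y
         + of_real (b1 * R) * dy A t y - a4 * of_real (R\<^sup>2) * dy (dy A) t y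
         + A t y * (b * of_real ((cmod (A t y))\<^sup>2) + c * of_real ((cmod (B t y))\<^sup>2)) \<and>
       dt B t y = (\<i> * of_real \<omega>0 + a3 * of_real \<tau>) * B t y
         + of_real (b1 * R) * dy B t y - a4 * of_real (R\<^sup>2) * dy (dy B) t y
         + B t y * (c * of_real ((cmod (A t y))\<^sup>2) + b * of_real ((cmod (B t y))\<^sup>2)))"

definition wave_amplitude ::
    "real \<Rightarrow> real \<Rightarrow> complex \<Rightarrow> complex \<Rightarrow> real \<Rightarrow> real \<Rightarrow> real \<Rightarrow> (real \<Rightarrow> real) \<Rightarrow> amplitude" where
  "wave_amplitude \<omega>0 b1 a3 a4 \<tau> \<beta> r \<theta> t y =
     of_real r * exp ((\<i> * of_real \<omega>0 + \<i> * of_real (Im a3 * \<tau>) + \<i> * of_real (Im a4 * \<beta>\<^sup>2)) * of_real t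
       + \<i> * of_real \<beta> * of_real (y + b1 * t) + \<i> * of_real (\<theta> t))"

text \<open>The coordinates are \<open>x\<close> (radial), \<open>y\<close> (azimuthal), \<open>z\<close> (axial), and the vector
  components \<open>1, 2, 3\<close> are taken in the same order. A mode defined on the gap only is
  to be extended by zero in \<open>x\<close>.\<close>

type_synonym mode = "real \<Rightarrow> real \<Rightarrow> real \<Rightarrow> complex ^ 3"

type_synonym velocity_field = "real \<Rightarrow> real \<Rightarrow> real \<Rightarrow> real \<Rightarrow> real ^ 3"

definition axial_reflection :: "mode \<Rightarrow> mode" where
  "axial_reflection \<zeta> x y z =
     (\<chi> j. if j = 3 then - (\<zeta> x y (- z) $ j) else \<zeta> x y (- z) $ j)"

text \<open>The flow is invariant under translations in \<open>y\<close> and \<open>z\<close>, so the critical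
  eigenvectors are Fourier modes in these variables; \<open>\<gamma> = 0\<close> (no \<open>y\<close>-dependence beyond
  that of the amplitudes) is allowed.\<close>

definition fourier_mode :: "real \<Rightarrow> real \<Rightarrow> (real \<Rightarrow> complex ^ 3) \<Rightarrow> mode" where
  "fourier_mode \<gamma> k U x y z = (\<chi> j. exp (\<i> * of_real (\<gamma> * y + k * z)) * U x $ j)"

text \<open>The sum below is its own conjugate; \<^const>\<open>Re\<close> only changes the type.\<close>

definition leading_velocity ::
    "mode \<Rightarrow> mode \<Rightarrow> amplitude \<Rightarrow> amplitude \<Rightarrow> velocity_field" where
  "leading_velocity \<zeta>1 \<zeta>2 A B t x y z =
     (\<chi> j. Re (A t y * \<zeta>1 x y z $ j + B t y * \<zeta>2 x y z $ j
        + cnj (A t y) * cnj (\<zeta>1 x y z $ j) + cnj (B t y) * cnj (\<zeta>2 x y z $ j)))"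

definition travels_azimuthally :: "velocity_field \<Rightarrow> bool" where
  "travels_azimuthally u \<longleftrightarrow>
     (\<exists>v. v \<noteq> 0 \<and> (\<forall>t x y z. u t x y z = u 0 x (y - v * t) z)) \<and>
     (\<exists>t x y y' z. u t x y z \<noteq> u t x y' z)"

definition travels_axially :: "velocity_field \<Rightarrow> bool" where
  "travels_axially u \<longleftrightarrow>
     (\<exists>v. v \<noteq> 0 \<and> (\<forall>t x y z. u t x y z = u 0 x y (z - v * t))) \<and>
     (\<exists>t x y z z'. u t x y z \<noteq> u t x y z')"

text \<open>Standing in \<open>z\<close>: each component has a fixed axial profile, hence fixed nodal planes,
  and only its amplitude evolves. The profile depends on the component because the
  reflection changes the sign of the axial velocity only.\<close>

definition standing_axially :: "velocity_field \<Rightarrow> bool" where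
  "standing_axially u \<longleftrightarrow>
     (\<exists>g h. \<forall>t x y z j. u t x y z $ j = g j t x y * h j z) \<and>
     (\<exists>t x y z z'. u t x y z \<noteq> u t x y z')"

definition helicoidal_wave :: "velocity_field \<Rightarrow> bool" where
  "helicoidal_wave u \<longleftrightarrow> travels_azimuthally u \<and> travels_axially u"

definition ribbon_wave :: "velocity_field \<Rightarrow> bool" where
  "ribbon_wave u \<longleftrightarrow> travels_azimuthally u \<and> standing_axially u"

end

theory Submission
  imports Defs
begin

text \<open>On a plane wave of frequency \<open>\<Omega>\<close> and wave number \<open>\<beta>\<close> every derivative acts as multiplication
  by a constant and the moduli are constant, so the system reduces to two complex dispersion
  relations, whose real parts fix the amplitudes and whose imaginary parts fix the slopes of the
  phases. With one vanishing amplitude the velocity depends on \<open>t, y, z\<close> through one phase only.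
  With equal amplitudes the two slopes agree, and the mode and its mirror image
  superpose to a wave in \<open>t, y\<close> times a cosine in \<open>z\<close>, or a sine for the axial component.\<close>

section \<open>Plane waves and their dispersion relations\<close>

definition plane_wave :: "real \<Rightarrow> real \<Rightarrow> real \<Rightarrow> real \<Rightarrow> amplitude" where
  "plane_wave r \<Omega> \<beta> p t y = of_real r * cis (\<Omega> * t + \<beta> * y + p)"

text \<open>The ansatz drifts with \<open>b1\<close> and \<open>Im a4 * \<beta>\<^sup>2\<close>,
  without the factors \<open>R\<close> and \<open>R\<^sup>2\<close> of the system. The free slope
  \<open>q\<close> absorbs the discrepancy, so the frequency of the plane wave is arbitrary.\<close>

lemma wave_amplitude_eq_plane_wave:
  "wave_amplitude \<omega>0 b1 a3 a4 \<tau> \<beta> r (\<lambda>t. p + q * t) =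
     plane_wave r (\<omega>0 + Im a3 * \<tau> + Im a4 * \<beta>\<^sup>2 + \<beta> * b1 + q) \<beta> p"
  by (intro ext) (simp add: wave_amplitude_def plane_wave_def cis_conv_exp algebra_simps)

lemma cmod_plane_wave [simp]: "cmod (plane_wave r \<Omega> \<beta> p t y) = \<bar>r\<bar>"
  by (simp add: plane_wave_def norm_mult)

lemma plane_wave_eq_0_iff [simp]: "plane_wave r \<Omega> \<beta> p t y = 0 \<longleftrightarrow> r = 0"
  by (simp add: plane_wave_def)

text \<open>The curve is an entire function restricted to the real line. The constant
  \<open>w\<close> lets one rule serve first derivatives (\<open>w = 1\<close>) and the second one
  in \<open>y\<close>.\<close>

lemma has_vector_derivative_cis_affine:
  "((\<lambda>s. w * cis (a * s + d)) has_vector_derivative \<i> * of_real a * (w * cis (a * s + d))) (at s)"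
proof -
  have "((\<lambda>z. w * exp (\<i> * (of_real a * z + of_real d))) has_field_derivative
      \<i> * of_real a * (w * exp (\<i> * (of_real a * of_real s + of_real d)))) (at (of_real s))"
    by (auto intro!: derivative_eq_intros)
  from has_vector_derivative_real_field[OF this] show ?thesis
    by (simp add: cis_conv_exp)
qed

lemma plane_wave_has_vector_derivative_t:
  "((\<lambda>s. w * plane_wave r \<Omega> \<beta> p s y) has_vector_derivative
    \<i> * of_real \<Omega> * (w * plane_wave r \<Omega> \<beta> p t y)) (at t)"
  using has_vector_derivative_cis_affine[of "w * of_real r" \<Omega> "\<beta> * y + p" t]
  by (simp add: plane_wave_def algebra_simps)

lemma plane_wave_has_vector_derivative_y:
  "((\<lambda>s. w * plane_wave r \<Omega> \<beta> p t s) has_vector_derivative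
    \<i> * of_real \<beta> * (w * plane_wave r \<Omega> \<beta> p t y)) (at y)"
  using has_vector_derivative_cis_affine[of "w * of_real r" \<beta> "\<Omega> * t + p" y]
  by (simp add: plane_wave_def algebra_simps)

lemma dt_plane_wave: "dt (plane_wave r \<Omega> \<beta> p) t y = \<i> * of_real \<Omega> * plane_wave r \<Omega> \<beta> p t y"
  unfolding dt_def
  by (rule vector_derivative_at[OF plane_wave_has_vector_derivative_t[of 1, unfolded mult_1]])

text \<open>An equation between functions, unlike \<open>dt_plane_wave\<close>, because it is
  rewritten under a second \<open>dy\<close>.\<close>

lemma dy_plane_wave: "dy (plane_wave r \<Omega> \<beta> p) = (\<lambda>t y. \<i> * of_real \<beta> * plane_wave r \<Omega> \<beta> p t y)"
  unfolding dy_def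
  by (intro ext vector_derivative_at[OF plane_wave_has_vector_derivative_y[of 1, unfolded mult_1]])

lemma dy_dy_plane_wave:
  "dy (dy (plane_wave r \<Omega> \<beta> p)) t y = - of_real (\<beta>\<^sup>2) * plane_wave r \<Omega> \<beta> p t y"
proof -
  have "dy (dy (plane_wave r \<Omega> \<beta> p)) t y = \<i> * of_real \<beta> * (\<i> * of_real \<beta> * plane_wave r \<Omega> \<beta> p t y)"
    unfolding dy_plane_wave unfolding dy_def
    by (rule vector_derivative_at[OF plane_wave_has_vector_derivative_y])
  also have "\<dots> = - of_real (\<beta>\<^sup>2) * plane_wave r \<Omega> \<beta> p t y"
    by (simp add: power2_eq_square algebra_simps)
  finally show ?thesis .
qed

lemma has_partials_plane_wave: "has_partials (plane_wave r \<Omega> \<beta> p)"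
  unfolding has_partials_def dy_plane_wave
  by (intro allI conjI
      differentiableI_vector[OF plane_wave_has_vector_derivative_t[of 1, unfolded mult_1]]
      differentiableI_vector[OF plane_wave_has_vector_derivative_y[of 1, unfolded mult_1]]
      differentiableI_vector[OF plane_wave_has_vector_derivative_y])

text \<open>Here \<open>m\<close> stands for the cubic coefficient, constant along plane waves, so
  one statement serves both equations. Cancelling a nonzero wave leaves one complex equation; its
  left side is purely imaginary, so the real part is a balance of growth and the imaginary part
  gives the frequency.\<close>

lemma plane_wave_amplitude_equation_iff:
  fixes a3 a4 m :: complex
  shows "dt (plane_wave r \<Omega> \<beta> p) t y = (\<i> * of_real \<omega>0 + a3 * of_real \<tau>) * plane_wave r \<Omega> \<beta> p t y
      + of_real (b1 * R) * dy (plane_wave r \<Omega> \<beta> p) t y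
      - a4 * of_real (R\<^sup>2) * dy (dy (plane_wave r \<Omega> \<beta> p)) t y + plane_wave r \<Omega> \<beta> p t y * m \<longleftrightarrow>
    r = 0 \<or> Re a3 * \<tau> + Re a4 * R\<^sup>2 * \<beta>\<^sup>2 + Re m = 0 \<and>
      \<Omega> = \<omega>0 + Im a3 * \<tau> + b1 * R * \<beta> + Im a4 * R\<^sup>2 * \<beta>\<^sup>2 + Im m"
    (is "?L \<longleftrightarrow> _")
proof -
  let ?P = "plane_wave r \<Omega> \<beta> p t y"
  let ?d = "\<i> * of_real \<omega>0 + a3 * of_real \<tau> + \<i> * of_real (b1 * R * \<beta>) + a4 * of_real (R\<^sup>2 * \<beta>\<^sup>2) + m"
  have "?L \<longleftrightarrow> ?P * (\<i> * of_real \<Omega>) = ?P * ?d"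
    unfolding dt_plane_wave dy_dy_plane_wave unfolding dy_plane_wave
    by (simp add: algebra_simps)
  also have "\<dots> \<longleftrightarrow> r = 0 \<or> \<i> * of_real \<Omega> = ?d"
    by (simp only: mult_cancel_left plane_wave_eq_0_iff)
  also have "\<i> * of_real \<Omega> = ?d \<longleftrightarrow> Re a3 * \<tau> + Re a4 * R\<^sup>2 * \<beta>\<^sup>2 + Re m = 0 \<and>
      \<Omega> = \<omega>0 + Im a3 * \<tau> + b1 * R * \<beta> + Im a4 * R\<^sup>2 * \<beta>\<^sup>2 + Im m"
    unfolding complex_eq_iff by (auto simp del: of_real_mult of_real_power simp: mult.assoc)
  finally show ?thesis .
qed

text \<open>The conditions for each equation are free of \<open>t\<close> and \<open>y\<close>, so
  the quantifiers over them collapse. A vanishing amplitude leaves its own frequency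
  unconstrained.\<close>

lemma gl_solution_plane_wave_iff:
  "gl_solution \<omega>0 b1 R a3 a4 b c \<tau> (plane_wave r0 \<Omega>0 \<beta> p0) (plane_wave r1 \<Omega>1 \<beta> p1) \<longleftrightarrow>
    (r0 = 0 \<or> Re a3 * \<tau> + Re a4 * R\<^sup>2 * \<beta>\<^sup>2 + Re b * r0\<^sup>2 + Re c * r1\<^sup>2 = 0 \<and>
      \<Omega>0 = \<omega>0 + Im a3 * \<tau> + b1 * R * \<beta> + Im a4 * R\<^sup>2 * \<beta>\<^sup>2 + Im b * r0\<^sup>2 + Im c * r1\<^sup>2) \<and>
    (r1 = 0 \<or> Re a3 * \<tau> + Re a4 * R\<^sup>2 * \<beta>\<^sup>2 + Re c * r0\<^sup>2 + Re b * r1\<^sup>2 = 0 \<and>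
      \<Omega>1 = \<omega>0 + Im a3 * \<tau> + b1 * R * \<beta> + Im a4 * R\<^sup>2 * \<beta>\<^sup>2 + Im c * r0\<^sup>2 + Im b * r1\<^sup>2)"
  unfolding gl_solution_def plane_wave_amplitude_equation_iff
  by (simp add: has_partials_plane_wave add.assoc del: of_real_power)

section \<open>Criteria for travelling waves\<close>

text \<open>Rotations by zero and by a quarter turn read off \<open>Re w\<close> and
  \<open>- Im w\<close>, which do not both vanish. This yields the nonconstancy demanded of
  travelling and standing waves.\<close>

lemma ex_Re_cis_mult_neq_0:
  assumes "w \<noteq> 0"
  shows "\<exists>\<phi>. Re (cis \<phi> * w) \<noteq> 0"
proof (rule ccontr)
  assume "\<not> ?thesis"
  then have "Re (cis 0 * w) = 0" "Re (cis (pi / 2) * w) = 0"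
    by blast+
  with assms show False
    by (simp add: complex_eq_iff)
qed

text \<open>Lines of constant phase move with speed \<open>- \<omega> / \<kappa>\<close>. At time 0
  every phase is attained at some \<open>y\<close>, so two different values of \<open>F\<close> show
  dependence on \<open>y\<close>.\<close>

lemma travels_azimuthallyI:
  assumes u: "\<And>t x y z. u t x y z = F x z (\<omega> * t + \<kappa> * y)"
    and "\<omega> \<noteq> 0" "\<kappa> \<noteq> 0" and neq: "F x z \<phi> \<noteq> F x z \<phi>'"
  shows "travels_azimuthally u"
proof -
  have "u t x y z = u 0 x (y - (- \<omega> / \<kappa>) * t) z" for t x y z
    using \<open>\<kappa> \<noteq> 0\<close> by (simp add: u algebra_simps)
  moreover have "u 0 x (\<phi> / \<kappa>) z \<noteq> u 0 x (\<phi>' / \<kappa>) z"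
    using \<open>\<kappa> \<noteq> 0\<close> neq by (simp add: u)
  moreover have "- \<omega> / \<kappa> \<noteq> 0"
    using assms by simp
  ultimately show ?thesis
    unfolding travels_azimuthally_def by blast
qed

lemma travels_axiallyI:
  assumes u: "\<And>t x y z. u t x y z = F x y (\<omega> * t + k * z)"
    and "\<omega> \<noteq> 0" "k \<noteq> 0" and neq: "F x y \<phi> \<noteq> F x y \<phi>'"
  shows "travels_axially u"
proof -
  have "u t x y z = u 0 x y (z - (- \<omega> / k) * t)" for t x y z
    using \<open>k \<noteq> 0\<close> by (simp add: u algebra_simps)
  moreover have "u 0 x y (\<phi> / k) \<noteq> u 0 x y (\<phi>' / k)"
    using \<open>k \<noteq> 0\<close> neq by (simp add: u)
  moreover have "- \<omega> / k \<noteq> 0"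
    using assms by simp
  ultimately show ?thesis
    unfolding travels_axially_def by blast
qed

lemma fourier_mode_nth: "fourier_mode \<gamma> k U x y z $ j = cis (\<gamma> * y + k * z) * U x $ j"
  by (simp only: fourier_mode_def cis_conv_exp vec_lambda_beta)

section \<open>Helicoidal waves\<close>

text \<open>The factor 2 comes from adding the complex conjugate.\<close>

definition helicoidal_profile :: "real \<Rightarrow> real \<Rightarrow> (real \<Rightarrow> complex ^ 3) \<Rightarrow> real \<Rightarrow> real \<Rightarrow> real ^ 3" where
  "helicoidal_profile r p U x \<phi> = (\<chi> j. 2 * r * Re (cis \<phi> * (cis p * U x $ j)))"

lemma leading_velocity_helicoidal:
  fixes \<zeta>2 :: mode
  shows "leading_velocity (fourier_mode \<gamma> k U) \<zeta>2 (plane_wave r \<omega> \<beta> p) (plane_wave 0 \<Omega> \<beta>' q) t x y z =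
    helicoidal_profile r p U x (\<omega> * t + (\<gamma> + \<beta>) * y + k * z)"
proof -
  have "plane_wave r \<omega> \<beta> p t y * fourier_mode \<gamma> k U x y z $ j =
      of_real r * (cis (\<omega> * t + (\<gamma> + \<beta>) * y + k * z) * (cis p * U x $ j))" for j
    by (simp only: plane_wave_def fourier_mode_nth)
       (simp add: algebra_simps flip: cis_mult)
  then show ?thesis
    by (simp add: leading_velocity_def helicoidal_profile_def vec_eq_iff
        flip: complex_cnj_mult) (simp add: plane_wave_def)
qed

text \<open>A half turn of the phase reverses the sign, so any phase with a nonzero component will
  do.\<close>

lemma ex_helicoidal_profile_neq:
  assumes "r \<noteq> 0" "U x \<noteq> 0"
  shows "\<exists>\<phi>. helicoidal_profile r p U x \<phi> \<noteq> helicoidal_profile r p U x (\<phi> + pi)"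
proof -
  obtain j where "U x $ j \<noteq> 0"
    using assms by (auto simp: vec_eq_iff)
  then obtain \<phi> where "Re (cis \<phi> * (cis p * U x $ j)) \<noteq> 0"
    using ex_Re_cis_mult_neq_0[of "cis p * U x $ j"] by auto
  moreover have "cis (\<phi> + pi) = - cis \<phi>"
    by (simp flip: cis_mult)
  ultimately have "helicoidal_profile r p U x \<phi> $ j \<noteq> helicoidal_profile r p U x (\<phi> + pi) $ j"
    using \<open>r \<noteq> 0\<close> by (simp add: helicoidal_profile_def del: cis.simps times_complex.simps)
  then show ?thesis
    by metis
qed

text \<open>The single phase is grouped in two ways: with \<open>k * z\<close> absorbed into the
  profile it travels in \<open>y\<close>, and with \<open>(\<gamma> + \<beta>) * y\<close> absorbed
  it travels in \<open>z\<close>.\<close>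

lemma helicoidal_wave_leading_velocity:
  fixes \<zeta>2 :: mode
  assumes "r \<noteq> 0" "U x \<noteq> 0" "k \<noteq> 0" "\<omega> \<noteq> 0" "\<gamma> + \<beta> \<noteq> 0"
  shows "helicoidal_wave (leading_velocity (fourier_mode \<gamma> k U) \<zeta>2
    (plane_wave r \<omega> \<beta> p) (plane_wave 0 \<Omega> \<beta>' q))"
proof -
  let ?F = "helicoidal_profile r p U"
  obtain \<phi> where \<phi>: "?F x \<phi> \<noteq> ?F x (\<phi> + pi)"
    using ex_helicoidal_profile_neq[of r U x p] assms by blast
  show ?thesis
    unfolding helicoidal_wave_def
  proof
    show "travels_azimuthally (leading_velocity (fourier_mode \<gamma> k U) \<zeta>2
        (plane_wave r \<omega> \<beta> p) (plane_wave 0 \<Omega> \<beta>' q))"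
      by (rule travels_azimuthallyI[where F = "\<lambda>x z s. ?F x (s + k * z)" and \<omega> = \<omega> and \<kappa> = "\<gamma> + \<beta>"
            and x = x and z = 0])
         (use assms \<phi> in \<open>auto simp: leading_velocity_helicoidal\<close>)
    show "travels_axially (leading_velocity (fourier_mode \<gamma> k U) \<zeta>2
        (plane_wave r \<omega> \<beta> p) (plane_wave 0 \<Omega> \<beta>' q))"
      by (rule travels_axiallyI[where F = "\<lambda>x y s. ?F x (s + (\<gamma> + \<beta>) * y)" and \<omega> = \<omega> and k = k
            and x = x and y = 0])
         (use assms \<phi> in \<open>auto simp: leading_velocity_helicoidal add_ac\<close>)
  qed
qed

section \<open>Ribbon waves\<close>

text \<open>One factor 2 comes from the conjugate, the other from the sum-to-product formula. The
  axial component gets \<open>\<i>\<close> because the reflection turns its sum into a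
  difference.\<close>

definition ribbon_profile ::
    "real \<Rightarrow> real \<Rightarrow> real \<Rightarrow> (real \<Rightarrow> complex ^ 3) \<Rightarrow> 3 \<Rightarrow> real \<Rightarrow> real \<Rightarrow> real" where
  "ribbon_profile r p q U j x \<phi> =
     4 * r * Re (cis \<phi> * (cis ((p + q) / 2) * (if j = 3 then \<i> else 1) * U x $ j))"

text \<open>Half the phase difference of the two waves shifts the nodal planes.\<close>

definition ribbon_axial_profile :: "real \<Rightarrow> real \<Rightarrow> real \<Rightarrow> 3 \<Rightarrow> real \<Rightarrow> real" where
  "ribbon_axial_profile p q k j z =
     (if j = 3 then sin ((p - q) / 2 + k * z) else cos ((p - q) / 2 + k * z))"

lemma cis_add_cis_minus: "cis (s + d) + cis (s - d) = cis s * of_real (2 * cos d)"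
  and cis_diff_cis_minus: "cis (s + d) - cis (s - d) = cis s * (\<i> * of_real (2 * sin d))"
  by (simp_all add: complex_eq_iff cos_add cos_diff sin_add sin_diff)

lemma leading_velocity_ribbon:
  "leading_velocity (fourier_mode \<gamma> k U) (axial_reflection (fourier_mode \<gamma> k U))
      (plane_wave r \<omega> \<beta> p) (plane_wave r \<omega> \<beta> q) t x y z $ j =
    ribbon_profile r p q U j x (\<omega> * t + (\<gamma> + \<beta>) * y) * ribbon_axial_profile p q k j z"
proof -
  let ?A = "plane_wave r \<omega> \<beta> p t y" and ?B = "plane_wave r \<omega> \<beta> q t y"
  let ?\<zeta> = "fourier_mode \<gamma> k U"
  define \<phi> where "\<phi> = \<omega> * t + (\<gamma> + \<beta>) * y"
  \<comment> \<open>Reflection replaces \<open>z\<close> by \<open>- z\<close>, so the two summands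
    have phases \<open>s + d\<close> and \<open>s - d\<close>, where \<open>s\<close> carries
    \<open>t\<close> and \<open>y\<close> and \<open>d\<close> carries \<open>z\<close>.\<close>
  define s where "s = \<phi> + (p + q) / 2"
  define d where "d = (p - q) / 2 + k * z"
  have 1: "?A * ?\<zeta> x y z $ j = of_real r * (cis (s + d) * U x $ j)"
  proof -
    have "?A * ?\<zeta> x y z $ j =
      of_real r * (cis (\<omega> * t + \<beta> * y + p) * cis (\<gamma> * y + k * z)) * U x $ j"
      by (simp add: plane_wave_def fourier_mode_nth del: cis.simps)
    also have "cis (\<omega> * t + \<beta> * y + p) * cis (\<gamma> * y + k * z) = cis (s + d)"
      unfolding cis_mult by (rule arg_cong[where f = cis]) (simp add: s_def d_def \<phi>_def field_simps)
    finally show ?thesis by simp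
  qed
  have 2: "?B * axial_reflection ?\<zeta> x y z $ j =
    of_real r * (cis (s - d) * (if j = 3 then - 1 else 1) * U x $ j)"
  proof -
    have "?B * axial_reflection ?\<zeta> x y z $ j =
      of_real r * (cis (\<omega> * t + \<beta> * y + q) * cis (\<gamma> * y - k * z)) * (if j = 3 then - 1 else 1) * U x $ j"
      by (simp add: plane_wave_def axial_reflection_def fourier_mode_nth)
    also have "cis (\<omega> * t + \<beta> * y + q) * cis (\<gamma> * y - k * z) = cis (s - d)"
      unfolding cis_mult by (rule arg_cong[where f = cis]) (simp add: s_def d_def \<phi>_def field_simps)
    finally show ?thesis by simp
  qed
  have Re_mult: "Re (of_real a * v) = a * Re v" for a v
    by simp
  have "leading_velocity ?\<zeta> (axial_reflection ?\<zeta>) (plane_wave r \<omega> \<beta> p) (plane_wave r \<omega> \<beta> q) t x y z $ j =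
    2 * Re (?A * ?\<zeta> x y z $ j + ?B * axial_reflection ?\<zeta> x y z $ j)"
    by (simp add: leading_velocity_def)
  also have "?A * ?\<zeta> x y z $ j + ?B * axial_reflection ?\<zeta> x y z $ j =
    of_real r * ((cis (s + d) + cis (s - d) * (if j = 3 then - 1 else 1)) * U x $ j)"
    unfolding 1 2 by (simp add: algebra_simps)
  also have "cis (s + d) + cis (s - d) * (if j = 3 then - 1 else 1) =
    cis s * (if j = 3 then \<i> else 1) * of_real (2 * ribbon_axial_profile p q k j z)"
    using cis_add_cis_minus[of s d] cis_diff_cis_minus[of s d]
    by (simp add: ribbon_axial_profile_def flip: d_def)
  also have "2 * Re (of_real r * (cis s * (if j = 3 then \<i> else 1) *
        of_real (2 * ribbon_axial_profile p q k j z) * U x $ j)) =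
      2 * Re (of_real (2 * r * ribbon_axial_profile p q k j z) * (cis s * (if j = 3 then \<i> else 1) * U x $ j))"
    by (simp only: of_real_mult mult_ac)
  also have "\<dots> = 4 * r * Re (cis s * (if j = 3 then \<i> else 1) * U x $ j) * ribbon_axial_profile p q k j z"
    unfolding Re_mult by simp
  also have "\<dots> = ribbon_profile r p q U j x \<phi> * ribbon_axial_profile p q k j z"
    by (simp only: ribbon_profile_def s_def cis_mult[symmetric] mult.assoc)
  finally show ?thesis
    by (simp only: \<phi>_def)
qed

lemma ex_ribbon_profile_neq_0:
  assumes "r \<noteq> 0" "U x $ j \<noteq> 0"
  shows "\<exists>\<phi>. ribbon_profile r p q U j x \<phi> \<noteq> 0"
  using ex_Re_cis_mult_neq_0[of "cis ((p + q) / 2) * (if j = 3 then \<i> else 1) * U x $ j"] assms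
  by (simp add: ribbon_profile_def del: cis.simps times_complex.simps)

lemma ribbon_profile_add_pi: "ribbon_profile r p q U j x (\<phi> + pi) = - ribbon_profile r p q U j x \<phi>"
proof -
  have "cis (\<phi> + pi) = - cis \<phi>"
    by (simp flip: cis_mult)
  then show ?thesis
    unfolding ribbon_profile_def by (simp only: mult_minus_left mult_minus_right uminus_complex.simps)
qed

text \<open>The phase takes every value as \<open>z\<close> varies; 0 and \<open>pi / 2\<close> give
  a node and a non-node of both sine and cosine, with the roles exchanged for the axial
  component.\<close>

lemma ex_ribbon_axial_profile:
  assumes "k \<noteq> 0"
  shows "\<exists>z z'. ribbon_axial_profile p q k j z \<noteq> 0 \<and> ribbon_axial_profile p q k j z' = 0"
proof -
  have "\<exists>z. (p - q) / 2 + k * z = d" for d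
    by (rule exI[of _ "(d - (p - q) / 2) / k"]) (use assms in simp)
  then obtain z z' where "(p - q) / 2 + k * z = 0" "(p - q) / 2 + k * z' = pi / 2"
    by metis
  then have "if j = 3 then ribbon_axial_profile p q k j z' \<noteq> 0 \<and> ribbon_axial_profile p q k j z = 0
    else ribbon_axial_profile p q k j z \<noteq> 0 \<and> ribbon_axial_profile p q k j z' = 0"
    by (simp only: ribbon_axial_profile_def) simp
  then show ?thesis
    by (metis (full_types))
qed

lemma ribbon_wave_leading_velocity:
  assumes "r \<noteq> 0" "U x \<noteq> 0" "k \<noteq> 0" "\<omega> \<noteq> 0" "\<gamma> + \<beta> \<noteq> 0"
  shows "ribbon_wave (leading_velocity (fourier_mode \<gamma> k U) (axial_reflection (fourier_mode \<gamma> k U))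
    (plane_wave r \<omega> \<beta> p) (plane_wave r \<omega> \<beta> q))" (is "ribbon_wave ?u")
proof -
  let ?G = "ribbon_profile r p q U" and ?h = "ribbon_axial_profile p q k"
  obtain j where j: "U x $ j \<noteq> 0"
    using assms by (auto simp: vec_eq_iff)
  obtain \<phi> where \<phi>: "?G j x \<phi> \<noteq> 0"
    using ex_ribbon_profile_neq_0[of r U x j] assms j by blast
  obtain z z' where z: "?h j z \<noteq> 0" and z': "?h j z' = 0"
    using ex_ribbon_axial_profile[OF \<open>k \<noteq> 0\<close>] by blast
  have u: "?u t x y z $ j = ?G j x (\<omega> * t + (\<gamma> + \<beta>) * y) * ?h j z" for t x y z j
    by (rule leading_velocity_ribbon)
  show ?thesis
    unfolding ribbon_wave_def
  proof
    show "travels_azimuthally ?u"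
    proof (rule travels_azimuthallyI)
      show "?u t x y z = (\<lambda>x z s. \<chi> j. ?G j x s * ?h j z) x z (\<omega> * t + (\<gamma> + \<beta>) * y)" for t x y z
        by (simp add: vec_eq_iff u)
      \<comment> \<open>Away from the nodal planes a half turn in \<open>t, y\<close> changes the
        sign of a nonzero component.\<close>
      have "?G j x \<phi> * ?h j z \<noteq> ?G j x (\<phi> + pi) * ?h j z"
        using \<phi> z by (simp add: ribbon_profile_add_pi)
      then show "(\<lambda>x z s. \<chi> j. ?G j x s * ?h j z) x z \<phi> \<noteq> (\<lambda>x z s. \<chi> j. ?G j x s * ?h j z) x z (\<phi> + pi)"
        by (auto simp: vec_eq_iff)
    qed (use assms in auto)
    \<comment> \<open>At time 0 this \<open>y\<close> realises the phase \<open>\<phi>\<close>;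
      comparing a node with a non-node shows dependence on \<open>z\<close>.\<close>
    have "?u 0 x (\<phi> / (\<gamma> + \<beta>)) z $ j \<noteq> ?u 0 x (\<phi> / (\<gamma> + \<beta>)) z' $ j"
      using \<phi> z z' \<open>\<gamma> + \<beta> \<noteq> 0\<close> by (simp add: u)
    then have "\<exists>t x y z z'. ?u t x y z \<noteq> ?u t x y z'"
      by metis
    moreover have "\<exists>g h. \<forall>t x y z j. ?u t x y z $ j = g j t x y * h j z"
      by (rule exI[of _ "\<lambda>j t x y. ?G j x (\<omega> * t + (\<gamma> + \<beta>) * y)"], rule exI[of _ ?h]) (simp add: u)
    ultimately show "standing_axially ?u"
      unfolding standing_axially_def by blast
  qed
qed

text \<open>Above onset a small amplitude keeps the net linear and cubic growth positive, and the
  damping of a suitable wave number \<open>\<beta>\<close> balances it.\<close>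

lemma ex_balancing_wave_number:
  fixes l d n :: real
  assumes "l > 0" "d > 0"
  shows "\<exists>\<beta> r. \<beta> \<noteq> 0 \<and> r \<noteq> 0 \<and> l - d * \<beta>\<^sup>2 + n * r\<^sup>2 = 0"
proof -
  \<comment> \<open>This choice keeps \<open>\<bar>n * r\<^sup>2\<bar>\<close> below
    \<open>l\<close> for either sign of \<open>n\<close>; the added 1 covers
    \<open>n = 0\<close>.\<close>
  define r where "r = sqrt (l / (2 * (\<bar>n\<bar> + 1)))"
  have r2: "r\<^sup>2 = l / (2 * (\<bar>n\<bar> + 1))" and "r > 0"
    using \<open>l > 0\<close> by (simp_all add: r_def)
  have "\<bar>n * r\<^sup>2\<bar> = (\<bar>n\<bar> / (\<bar>n\<bar> + 1)) * (l / 2)"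
    unfolding r2 using \<open>l > 0\<close> by (simp add: abs_mult)
  also have "\<dots> < 1 * l"
    using \<open>l > 0\<close> by (intro mult_strict_mono) auto
  finally have pos: "l + n * r\<^sup>2 > 0"
    by linarith
  \<comment> \<open>Obtained by solving the balance for \<open>\<beta>\<^sup>2\<close>.\<close>
  define \<beta> where "\<beta> = sqrt ((l + n * r\<^sup>2) / d)"
  have "\<beta>\<^sup>2 = (l + n * r\<^sup>2) / d" "\<beta> > 0"
    using pos \<open>d > 0\<close> by (simp_all add: \<beta>_def)
  then have "l - d * \<beta>\<^sup>2 + n * r\<^sup>2 = 0"
    using \<open>d > 0\<close> by simp
  with \<open>r > 0\<close> \<open>\<beta> > 0\<close> show ?thesis
    by (metis less_irrefl)
qed

section \<open>Dispersion relations, existence and flow type for the ansatz\<close>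

theorem theorem1:
  fixes \<omega>0 b1 R T\<^sub>c \<gamma> k :: real
    and a3 a4 b c :: complex
    and U :: "real \<Rightarrow> complex ^ 3"
    and \<zeta>1 \<zeta>2 :: mode
    and W :: "real \<Rightarrow> real \<Rightarrow> real \<Rightarrow> (real \<Rightarrow> real) \<Rightarrow> amplitude"
    and sol :: "real \<Rightarrow> amplitude \<Rightarrow> amplitude \<Rightarrow> bool"
  defines "W \<equiv> \<lambda>T \<beta> r \<theta>. wave_amplitude \<omega>0 b1 a3 a4 (T - T\<^sub>c) \<beta> r \<theta>"
    and "sol \<equiv> \<lambda>T A B. gl_solution \<omega>0 b1 R a3 a4 b c (T - T\<^sub>c) A B"
  assumes "R > 0" and "Re a3 > 0" and "Re a4 < 0"
    and "k \<noteq> 0" and "\<exists>x. U x \<noteq> 0"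
    and "\<zeta>1 = fourier_mode \<gamma> k U" and "\<zeta>2 = axial_reflection \<zeta>1"
  shows
    "(\<forall>T \<beta> r0 r1 p0 q0 p1 q1.
        sol T (W T \<beta> r0 (\<lambda>t. p0 + q0 * t)) (W T \<beta> r1 (\<lambda>t. p1 + q1 * t)) \<longleftrightarrow>
          (r0 = 0 \<or>
            Re a3 * (T - T\<^sub>c) + Re a4 * R\<^sup>2 * \<beta>\<^sup>2 + Re b * r0\<^sup>2 + Re c * r1\<^sup>2 = 0 \<and>
            q0 = Im a4 * (R\<^sup>2 - 1) * \<beta>\<^sup>2 + b1 * (R - 1) * \<beta> + Im b * r0\<^sup>2 + Im c * r1\<^sup>2) \<and>
          (r1 = 0 \<or>
            Re a3 * (T - T\<^sub>c) + Re a4 * R\<^sup>2 * \<beta>\<^sup>2 + Re c * r0\<^sup>2 + Re b * r1\<^sup>2 = 0 \<and>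
            q1 = Im a4 * (R\<^sup>2 - 1) * \<beta>\<^sup>2 + b1 * (R - 1) * \<beta> + Im c * r0\<^sup>2 + Im b * r1\<^sup>2)) \<and>
     (\<forall>\<beta> r p0 p1. r \<noteq> 0 \<longrightarrow>
        (\<exists>T q0 q1. sol T (W T \<beta> r (\<lambda>t. p0 + q0 * t)) (W T \<beta> 0 (\<lambda>t. p1 + q1 * t))) \<and>
        (\<exists>T q0 q1. sol T (W T \<beta> r (\<lambda>t. p0 + q0 * t)) (W T \<beta> r (\<lambda>t. p1 + q1 * t)))) \<and>
     (\<forall>T p0 p1. T > T\<^sub>c \<longrightarrow>
        (\<exists>\<beta> r q0 q1. \<beta> \<noteq> 0 \<and> r \<noteq> 0 \<and>
           sol T (W T \<beta> r (\<lambda>t. p0 + q0 * t)) (W T \<beta> 0 (\<lambda>t. p1 + q1 * t))) \<and>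
        (\<exists>\<beta> r q0 q1. \<beta> \<noteq> 0 \<and> r \<noteq> 0 \<and>
           sol T (W T \<beta> r (\<lambda>t. p0 + q0 * t)) (W T \<beta> r (\<lambda>t. p1 + q1 * t)))) \<and>
     (\<forall>T \<beta> r0 r1 p0 q0 p1 q1 A B u \<omega>.
        A = W T \<beta> r0 (\<lambda>t. p0 + q0 * t) \<longrightarrow>
        B = W T \<beta> r1 (\<lambda>t. p1 + q1 * t) \<longrightarrow>
        sol T A B \<longrightarrow>
        u = leading_velocity \<zeta>1 \<zeta>2 A B \<longrightarrow>
        \<omega> = \<omega>0 + Im a3 * (T - T\<^sub>c) + Im a4 * \<beta>\<^sup>2 + \<beta> * b1 + q0 \<longrightarrow>
          (r0 \<noteq> 0 \<and> r1 = 0 \<longrightarrow>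
             (\<exists>F. \<forall>t x y z. u t x y z = F x (\<omega> * t + (\<gamma> + \<beta>) * y + k * z)) \<and>
             (\<omega> \<noteq> 0 \<and> \<gamma> + \<beta> \<noteq> 0 \<longrightarrow> helicoidal_wave u)) \<and>
          (r0 = r1 \<and> r0 \<noteq> 0 \<longrightarrow>
             (\<exists>G h. \<forall>t x y z j. u t x y z $ j = G j x (\<omega> * t + (\<gamma> + \<beta>) * y) * h j z) \<and>
             (\<omega> \<noteq> 0 \<and> \<gamma> + \<beta> \<noteq> 0 \<longrightarrow> ribbon_wave u)))"
proof -
  \<comment> \<open>Subtracting the frequency built into the ansatz from the dispersion relation
    leaves the factors \<open>R\<^sup>2 - 1\<close> and \<open>R - 1\<close>.\<close>
  have sol_iff: "sol T (W T \<beta> r0 (\<lambda>t. p0 + q0 * t)) (W T \<beta> r1 (\<lambda>t. p1 + q1 * t)) \<longleftrightarrow>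
      (r0 = 0 \<or>
        Re a3 * (T - T\<^sub>c) + Re a4 * R\<^sup>2 * \<beta>\<^sup>2 + Re b * r0\<^sup>2 + Re c * r1\<^sup>2 = 0 \<and>
        q0 = Im a4 * (R\<^sup>2 - 1) * \<beta>\<^sup>2 + b1 * (R - 1) * \<beta> + Im b * r0\<^sup>2 + Im c * r1\<^sup>2) \<and>
      (r1 = 0 \<or>
        Re a3 * (T - T\<^sub>c) + Re a4 * R\<^sup>2 * \<beta>\<^sup>2 + Re c * r0\<^sup>2 + Re b * r1\<^sup>2 = 0 \<and>
        q1 = Im a4 * (R\<^sup>2 - 1) * \<beta>\<^sup>2 + b1 * (R - 1) * \<beta> + Im c * r0\<^sup>2 + Im b * r1\<^sup>2)"
    for T \<beta> r0 r1 p0 q0 p1 q1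
    unfolding sol_def W_def wave_amplitude_eq_plane_wave gl_solution_plane_wave_iff
    by (intro arg_cong2[where f = "(\<and>)"] arg_cong2[where f = "(\<or>)"] refl)
       (auto simp: algebra_simps)
  \<comment> \<open>The slopes can be chosen to satisfy the imaginary parts, so only the real
    balance remains to be met.\<close>
  have single: "\<exists>q0 q1. sol T (W T \<beta> r (\<lambda>t. p0 + q0 * t)) (W T \<beta> 0 (\<lambda>t. p1 + q1 * t))"
    if "Re a3 * (T - T\<^sub>c) + Re a4 * R\<^sup>2 * \<beta>\<^sup>2 + Re b * r\<^sup>2 = 0" for T \<beta> r p0 p1
    using that unfolding sol_iff by simp
  \<comment> \<open>For equal amplitudes both equations give the same real balance, with
    \<open>b + c\<close> in place of \<open>b\<close>.\<close>
  have equal: "\<exists>q0 q1. sol T (W T \<beta> r (\<lambda>t. p0 + q0 * t)) (W T \<beta> r (\<lambda>t. p1 + q1 * t))"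
    if "Re a3 * (T - T\<^sub>c) + Re a4 * R\<^sup>2 * \<beta>\<^sup>2 + Re (b + c) * r\<^sup>2 = 0" for T \<beta> r p0 p1
  proof -
    have "Re a3 * (T - T\<^sub>c) + Re a4 * R\<^sup>2 * \<beta>\<^sup>2 + Re b * r\<^sup>2 + Re c * r\<^sup>2 = 0"
      "Re a3 * (T - T\<^sub>c) + Re a4 * R\<^sup>2 * \<beta>\<^sup>2 + Re c * r\<^sup>2 + Re b * r\<^sup>2 = 0"
      using that by (simp_all add: algebra_simps)
    then show ?thesis
      unfolding sol_iff by simp
  qed
  \<comment> \<open>The balance is affine in \<open>T\<close> with slope \<open>Re a3\<close>, which
    is positive.\<close>
  have T_exists: "\<exists>T. Re a3 * (T - T\<^sub>c) + Re a4 * R\<^sup>2 * \<beta>\<^sup>2 + n * r\<^sup>2 = 0" for \<beta> r n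
    by (rule exI[of _ "T\<^sub>c - (Re a4 * R\<^sup>2 * \<beta>\<^sup>2 + n * r\<^sup>2) / Re a3"]) (use \<open>Re a3 > 0\<close> in simp)
  have \<beta>_exists: "\<exists>\<beta> r. \<beta> \<noteq> 0 \<and> r \<noteq> 0 \<and> Re a3 * (T - T\<^sub>c) + Re a4 * R\<^sup>2 * \<beta>\<^sup>2 + n * r\<^sup>2 = 0"
    if "T > T\<^sub>c" for T n
    using ex_balancing_wave_number[of "Re a3 * (T - T\<^sub>c)" "- Re a4 * R\<^sup>2" n] that
      \<open>Re a3 > 0\<close> \<open>Re a4 < 0\<close> \<open>R > 0\<close> by (simp add: mult_neg_pos)
  obtain x where x: "U x \<noteq> 0"
    using assms by blast
  show ?thesis
  proof (intro conjI)
    show "\<forall>\<beta> r p0 p1. r \<noteq> 0 \<longrightarrow>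
        (\<exists>T q0 q1. sol T (W T \<beta> r (\<lambda>t. p0 + q0 * t)) (W T \<beta> 0 (\<lambda>t. p1 + q1 * t))) \<and>
        (\<exists>T q0 q1. sol T (W T \<beta> r (\<lambda>t. p0 + q0 * t)) (W T \<beta> r (\<lambda>t. p1 + q1 * t)))"
      using single equal T_exists by meson
    show "\<forall>T p0 p1. T > T\<^sub>c \<longrightarrow>
        (\<exists>\<beta> r q0 q1. \<beta> \<noteq> 0 \<and> r \<noteq> 0 \<and>
           sol T (W T \<beta> r (\<lambda>t. p0 + q0 * t)) (W T \<beta> 0 (\<lambda>t. p1 + q1 * t))) \<and>
        (\<exists>\<beta> r q0 q1. \<beta> \<noteq> 0 \<and> r \<noteq> 0 \<and>
           sol T (W T \<beta> r (\<lambda>t. p0 + q0 * t)) (W T \<beta> r (\<lambda>t. p1 + q1 * t)))"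
      using single equal \<beta>_exists by meson
  next
    show "\<forall>T \<beta> r0 r1 p0 q0 p1 q1 A B u \<omega>.
        A = W T \<beta> r0 (\<lambda>t. p0 + q0 * t) \<longrightarrow>
        B = W T \<beta> r1 (\<lambda>t. p1 + q1 * t) \<longrightarrow>
        sol T A B \<longrightarrow>
        u = leading_velocity \<zeta>1 \<zeta>2 A B \<longrightarrow>
        \<omega> = \<omega>0 + Im a3 * (T - T\<^sub>c) + Im a4 * \<beta>\<^sup>2 + \<beta> * b1 + q0 \<longrightarrow>
          (r0 \<noteq> 0 \<and> r1 = 0 \<longrightarrow>
             (\<exists>F. \<forall>t x y z. u t x y z = F x (\<omega> * t + (\<gamma> + \<beta>) * y + k * z)) \<and>
             (\<omega> \<noteq> 0 \<and> \<gamma> + \<beta> \<noteq> 0 \<longrightarrow> helicoidal_wave u)) \<and>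
          (r0 = r1 \<and> r0 \<noteq> 0 \<longrightarrow>
             (\<exists>G h. \<forall>t x y z j. u t x y z $ j = G j x (\<omega> * t + (\<gamma> + \<beta>) * y) * h j z) \<and>
             (\<omega> \<noteq> 0 \<and> \<gamma> + \<beta> \<noteq> 0 \<longrightarrow> ribbon_wave u))"
    proof (intro allI impI, goal_cases)
      case (1 T \<beta> r0 r1 p0 q0 p1 q1 A B u \<omega>)
      have A: "A = plane_wave r0 \<omega> \<beta> p0"
        using 1 by (simp add: W_def wave_amplitude_eq_plane_wave)
      \<comment> \<open>Since \<open>\<omega>\<close> is built from \<open>q0\<close>, the frequency
        of \<open>B\<close> is off by \<open>q1 - q0\<close>.\<close>
      have B: "B = plane_wave r1 (\<omega> - q0 + q1) \<beta> p1"
        using 1 by (simp add: W_def wave_amplitude_eq_plane_wave)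
      have u: "u = leading_velocity (fourier_mode \<gamma> k U) (axial_reflection (fourier_mode \<gamma> k U)) A B"
        using 1 assms by simp
      show ?case
      proof (intro conjI impI)
        assume "r0 \<noteq> 0 \<and> r1 = 0"
        then show "\<exists>F. \<forall>t x y z. u t x y z = F x (\<omega> * t + (\<gamma> + \<beta>) * y + k * z)"
          unfolding u A B by (auto simp: leading_velocity_helicoidal)
      next
        assume "r0 \<noteq> 0 \<and> r1 = 0" "\<omega> \<noteq> 0 \<and> \<gamma> + \<beta> \<noteq> 0"
        then show "helicoidal_wave u"
          unfolding u A B using helicoidal_wave_leading_velocity x \<open>k \<noteq> 0\<close> by blast
      next
        assume r: "r0 = r1 \<and> r0 \<noteq> 0"
        have "sol T (W T \<beta> r0 (\<lambda>t. p0 + q0 * t)) (W T \<beta> r1 (\<lambda>t. p1 + q1 * t))"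
          using 1 by simp
        \<comment> \<open>Here the system enters: for equal nonzero amplitudes the cubic frequency
          shifts coincide, which gives the common frequency a wave standing in \<open>z\<close>
          requires.\<close>
        with r have "q1 = q0"
          by (simp add: sol_iff)
        with r have u': "u = leading_velocity (fourier_mode \<gamma> k U) (axial_reflection (fourier_mode \<gamma> k U))
            (plane_wave r0 \<omega> \<beta> p0) (plane_wave r0 \<omega> \<beta> p1)"
          unfolding u A B by simp
        show "\<exists>G h. \<forall>t x y z j. u t x y z $ j = G j x (\<omega> * t + (\<gamma> + \<beta>) * y) * h j z"
          unfolding u' leading_velocity_ribbon by blast
        assume "\<omega> \<noteq> 0 \<and> \<gamma> + \<beta> \<noteq> 0"
        with r show "ribbon_wave u"
          unfolding u' using ribbon_wave_leading_velocity x \<open>k \<noteq> 0\<close> by blast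
      qed
    qed
  qed (use sol_iff in blast)
qed

end
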